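(* Let $G$ be a finite simple connected graph with maximum degree $\Delta(G)=4$. Suppose that $G$ contains six distinct vertices $x,y,z,u,v,w$ such that $xy,\,yz,\,yv,\,vu,\,vw\in E(G)$, with $d_G(x)=d_G(z)=d_G(u)=d_G(w)=3$ and $d_G(y)=d_G(v)=4$. Let $e=xy$. If $\chi'(G-e)=4$, then $\chi'(G)=4$.
   Context: $d_G(a)$ denotes the degree of the vertex $a$ in $G$. $\chi'(G)$ denotes the chromatic index, the least $k$ such that $G$ has a proper $k$-edge-coloring. $G-e$ is the graph obtained from $G$ by deleting the edge $e$ (keeping all vertices). The listed edges are required to be present; further edges of $G$ among the listed vertices are allowed subject to the degree conditions (the configuration is not required to be induced). *)

theory Defs
  imports Main
begin

text \<open>A finite simple graph is a finite vertex set \<open>V\<close> together with a set \<open>E\<close> of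
  two-element subsets of \<open>V\<close>.\<close>

definition fin_simple_graph :: "'a set \<Rightarrow> 'a set set \<Rightarrow> bool" where
  "fin_simple_graph V E \<longleftrightarrow> finite V \<and> (\<forall>e\<in>E. e \<subseteq> V \<and> card e = 2)"

definition degree :: "'a set set \<Rightarrow> 'a \<Rightarrow> nat" where
  "degree E a = card {e \<in> E. a \<in> e}"

definition max_degree :: "'a set \<Rightarrow> 'a set set \<Rightarrow> nat" where
  "max_degree V E = Max (degree E ` V)"

text \<open>The empty graph does not count as connected.\<close>

definition connected_graph :: "'a set \<Rightarrow> 'a set set \<Rightarrow> bool" where
  "connected_graph V E \<longleftrightarrow>
     V \<noteq> {} \<and> (\<forall>a\<in>V. \<forall>b\<in>V. (a, b) \<in> {(p, q). {p, q} \<in> E}\<^sup>*)"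

definition proper_edge_coloring :: "'a set set \<Rightarrow> nat \<Rightarrow> ('a set \<Rightarrow> nat) \<Rightarrow> bool" where
  "proper_edge_coloring E k c \<longleftrightarrow>
     c ` E \<subseteq> {..<k} \<and> (\<forall>e\<in>E. \<forall>f\<in>E. e \<noteq> f \<and> e \<inter> f \<noteq> {} \<longrightarrow> c e \<noteq> c f)"

text \<open>Isolated vertices are irrelevant here, so the chromatic index takes only the edge set.
  For finite \<open>E\<close> some \<open>k\<close> always qualifies, so the minimum is attained.\<close>

definition chromatic_index :: "'a set set \<Rightarrow> nat" where
  "chromatic_index E = (LEAST k. \<exists>c. proper_edge_coloring E k c)"

end

theory Submission
  imports Defs
begin

text \<open>Delete the five edges \<open>xy\<close>, \<open>yz\<close>, \<open>yv\<close>, \<open>vu\<close>, \<open>vw\<close> and keep a 4-colouring of the remaining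
  graph \<open>H\<close>. Whether it extends to \<open>G\<close> depends only on the colours used by \<open>H\<close> at the six vertices:
  one colour at each of \<open>y\<close> and \<open>v\<close>, two at each of \<open>x\<close>, \<open>z\<close>, \<open>u\<close>, \<open>w\<close>. Exchanging two colours
  \<open>a\<close>, \<open>b\<close> along a Kempe chain changes these sets only at the vertices where exactly one of \<open>a\<close>, \<open>b\<close>
  is used, and a chain has at most two such ends. This gives a finite game: the prover names a pair
  of colours and an end of a chain, the adversary names its other end. The prover wins this game from
  every position that comes from a colouring of \<open>G - xy\<close>; after permuting the colours and possibly
  exchanging \<open>u\<close> with \<open>w\<close> there are 486 of these, of which 350 extend at once. The winning strategies
  for the other 136 were found by a computer search and are checked here by rewriting.\<close>

section \<open>The recolouring game\<close>

datatype colour = C0 | C1 | C2 | C3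

definition swap_colour :: "colour \<Rightarrow> colour \<Rightarrow> colour \<Rightarrow> colour" where
  "swap_colour a b c = (if c = a then b else if c = b then a else c)"

text \<open>A state lists the colours used in \<open>H\<close> at \<open>y\<close>, \<open>v\<close>, \<open>x\<close>, \<open>z\<close>, \<open>u\<close>, \<open>w\<close>, in this order.\<close>

type_synonym state = "colour list list"

definition chain_end :: "colour \<Rightarrow> colour \<Rightarrow> colour list \<Rightarrow> bool" where
  "chain_end a b S \<longleftrightarrow> (a \<in> set S) \<noteq> (b \<in> set S)"

definition swap_at :: "colour \<Rightarrow> colour \<Rightarrow> nat \<Rightarrow> state \<Rightarrow> state" where
  "swap_at a b i s = s[i := map (swap_colour a b) (s ! i)]"

text \<open>The case \<open>i = j\<close> is kept apart because two exchanges at the same vertex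
  would cancel.\<close>

definition swap_ends :: "colour \<Rightarrow> colour \<Rightarrow> nat \<Rightarrow> nat \<Rightarrow> state \<Rightarrow> state" where
  "swap_ends a b i j s = (if i = j then swap_at a b i s else swap_at a b j (swap_at a b i s))"

text \<open>A link \<open>(a, b, i, j)\<close> records that some union of \<open>a\<close>-\<open>b\<close> chains ends, among the six vertices,
  exactly at \<open>i\<close> and \<open>j\<close>; here \<open>i = j\<close> means that the other end is elsewhere. It stays valid
  when colours are exchanged for the same or the disjoint pair.\<close>

type_synonym link = "colour \<times> colour \<times> nat \<times> nat"

definition compatible :: "colour \<Rightarrow> colour \<Rightarrow> link \<Rightarrow> bool" where
  "compatible a b l = (case l of (a', b', i, j) \<Rightarrow>
     a' = a \<and> b' = b \<or> a' \<noteq> a \<and> a' \<noteq> b \<and> b' \<noteq> a \<and> b' \<noteq> b)"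

definition linked :: "colour \<Rightarrow> colour \<Rightarrow> link list \<Rightarrow> nat \<Rightarrow> bool" where
  "linked a b K m = list_ex (\<lambda>(a', b', i, j). a' = a \<and> b' = b \<and> (m = i \<or> m = j)) K"

text \<open>Candidates for the other end of a new chain. An end on a recorded link for the same pair
  is excluded, since that link already accounts for its chain.\<close>

definition open_ends :: "colour \<Rightarrow> colour \<Rightarrow> state \<Rightarrow> link list \<Rightarrow> nat list" where
  "open_ends a b s K =
     filter (\<lambda>m. chain_end a b (s ! m) \<and> \<not> linked a b K m) [0..<length s]"

definition colours :: "colour list" where
  "colours = [C0, C1, C2, C3]"

text \<open>One side of the double star: \<open>P\<close> belongs to its centre, \<open>X\<close>
  and \<open>Z\<close> to its two leaves. The central edge \<open>yv\<close> gets \<open>m\<close>,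
  the two pendant edges get \<open>i\<close> and \<open>j\<close>.\<close>

definition side_ok :: "colour \<Rightarrow> colour list \<Rightarrow> colour list \<Rightarrow> colour list \<Rightarrow> bool" where
  "side_ok m P X Z \<longleftrightarrow> m \<notin> set P \<and>
     list_ex (\<lambda>i. i \<noteq> m \<and> i \<notin> set P \<and> i \<notin> set X \<and>
       list_ex (\<lambda>j. j \<noteq> m \<and> j \<noteq> i \<and> j \<notin> set P \<and> j \<notin> set Z) colours) colours"

definition goal :: "state \<Rightarrow> bool" where
  "goal s \<longleftrightarrow> list_ex (\<lambda>m. side_ok m (s ! 0) (s ! 2) (s ! 3) \<and> side_ok m (s ! 1) (s ! 4) (s ! 5)) colours"

text \<open>\<open>Swap a b i Ts\<close> exchanges \<open>a\<close> and \<open>b\<close> on the chain ending at \<open>i\<close>; \<open>Ts\<close> lists the continuations,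
  one for each possible other end, with \<open>Done\<close> for those missing at the end of the list. \<open>Undo\<close>
  reverts the exchange made before the last one and keeps the last one.\<close>

datatype strategy = Done | Undo strategy | Swap colour colour nat "strategy list"

text \<open>The values are functions of state and links, so that the recursion through
  \<open>Ts\<close> is primitive and each continuation runs on its own successor state. Links that
  an exchange might destroy are filtered out. \<open>Undo\<close> exchanges along the second
  recorded link, because a repeated exchange along one link is its own inverse.\<close>

primrec check :: "strategy \<Rightarrow> state \<Rightarrow> link list \<Rightarrow> bool" where
  "check Done = (\<lambda>s K. goal s)"
| "check (Undo T) = (\<lambda>s K. case K of
     _ # (a, b, i, j) # _ \<Rightarrow> check T (swap_ends a b i j s) (filter (compatible a b) K) | _ \<Rightarrow> False)"
| "check (Swap a b i Ts) = (\<lambda>s K. let K' = filter (compatible a b) K; js = open_ends a b s K' in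
     i \<in> set js \<and>
     list_all (\<lambda>(j, test). test (swap_ends a b i j s) ((a, b, i, j) # K'))
       (zip js (map check Ts @ replicate (length js) (\<lambda>s K. goal s))))"

definition colour_pairs :: "colour list list" where
  "colour_pairs = [[C0, C1], [C0, C2], [C0, C3], [C1, C2], [C1, C3], [C2, C3]]"

text \<open>The positions for \<open>yz\<close>, \<open>yv\<close> coloured \<open>C0\<close>, \<open>C1\<close> and the fourth edge at \<open>y\<close> coloured \<open>C2\<close>; the edges
  \<open>vu\<close>, \<open>vw\<close> have the colours \<open>a\<close>, \<open>b\<close>.\<close>

definition initial_states :: "state list" where
  "initial_states = [[[C2], [q], X, Z, U, W].
     (q, a, b) \<leftarrow> [(C0, C2, C3), (C2, C0, C3), (C3, C0, C2)],
     X \<leftarrow> colour_pairs, Z \<leftarrow> colour_pairs, C0 \<notin> set Z,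
     U \<leftarrow> colour_pairs, a \<notin> set U, W \<leftarrow> colour_pairs, b \<notin> set W]"

text \<open>Aligned with the positions of \<open>initial_states\<close> that violate
  \<open>goal\<close>, in the order of that list.\<close>

definition strategies :: "strategy list" where
  "strategies = [
   Swap C1 C3 2 [],
   Swap C0 C2 0 [Done, Done, Swap C1 C3 4 [Undo Done, Swap C0 C3 0 [], Done, Undo Done], Done,
     Swap C0 C2 1 [Done, Undo Done]],
   Swap C0 C1 1 [Done, Swap C1 C3 1 [Done, Swap C2 C3 0 []]],
   Swap C1 C2 0 [Swap C0 C1 0 []],
   Swap C0 C1 5 [Done, Done, Swap C0 C3 1 [Done, Swap C2 C3 0 []]],
   Swap C1 C3 2 [],
   Swap C2 C3 0 [Done, Swap C1 C3 0 [Swap C0 C1 0 []]],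
   Swap C2 C3 2 [Done, Done, Done, Swap C1 C2 0 [Done, Done, Done, Swap C0 C1 0 []]],
   Swap C2 C3 0 [Done, Swap C0 C1 1 [Done, Undo (Swap C1 C2 0 [Done, Swap C1 C2 5 [], Done,
     Done, Done, Swap C2 C3 2 []])]],
   Swap C0 C1 1 [Done, Swap C0 C1 3 [Done, Done, Undo (Swap C0 C2 0 [])], Swap C0 C2 0 [],
     Done, Swap C2 C3 2 [Done, Undo Done, Done, Swap C2 C3 0 []]],
   Swap C1 C3 2 [],
   Swap C0 C1 1 [Done, Done, Swap C0 C3 3 [Done, Done, Swap C0 C1 1 [Swap C0 C2 0 []]]],
   Swap C0 C2 1 [Done, Done, Done, Swap C0 C2 0 [Done, Done, Done, Undo Done], Done, Swap C1 C3
     2 [Done, Undo Done, Undo Done, Swap C2 C3 1 []]],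
   Swap C1 C3 2 [Done, Done, Swap C2 C3 0 [Swap C0 C3 0 []]],
   Swap C0 C1 1 [Done, Done, Done, Swap C1 C3 1 [Swap C2 C3 0 []]],
   Swap C2 C3 0 [],
   Swap C2 C3 0 [],
   Swap C2 C3 0 [],
   Swap C2 C3 0 [],
   Swap C1 C2 0 [],
   Swap C2 C3 0 [Done, Done, Done, Swap C1 C2 2 [], Swap C2 C3 4 []],
   Swap C2 C3 0 [],
   Swap C2 C3 0 [Done, Done, Done, Swap C1 C2 2 [], Swap C2 C3 4 []],
   Swap C0 C3 2 [Done, Done, Swap C0 C2 0 []],
   Swap C1 C3 3 [],
   Swap C1 C3 3 [Done, Done, Swap C0 C1 1 [Swap C1 C2 0 []]],
   Swap C0 C3 1 [Swap C2 C3 0 []],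
   Swap C0 C1 1 [Done, Done, Swap C0 C3 2 [Done, Done, Swap C2 C3 0 [Swap C1 C3 0 []]]],
   Swap C0 C1 1 [Done, Done, Done, Swap C2 C3 0 [Done, Done, Done, Undo (Swap C0 C3 1 [Swap C0
     C3 3 [], Done, Done, Swap C0 C1 3 []])]],
   Swap C1 C3 2 [],
   Swap C1 C3 2 [Done, Done, Swap C0 C1 1 [Swap C1 C2 0 []]],
   Swap C0 C3 1 [Swap C2 C3 0 []],
   Swap C0 C1 1 [Done, Done, Swap C0 C3 2 [Swap C0 C2 0 [Swap C0 C1 0 []]]],
   Swap C0 C1 1 [Done, Done, Done, Swap C2 C3 0 [Done, Done, Done, Undo (Swap C0 C3 1 [Swap C0
     C3 2 [], Done, Swap C0 C1 2 []])]],
   Swap C1 C3 2 [],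
   Swap C1 C3 2 [],
   Swap C1 C3 2 [],
   Swap C1 C3 2 [],
   Swap C1 C3 2 [],
   Swap C1 C2 0 [Swap C0 C1 0 [Done, Done, Done, Swap C0 C2 0 []]],
   Swap C0 C1 2 [],
   Swap C1 C2 1 [],
   Swap C1 C2 0 [Swap C1 C3 0 [Done, Done, Done, Swap C2 C3 0 []]],
   Swap C1 C3 2 [Done, Done, Swap C1 C2 0 []],
   Swap C1 C3 2 [],
   Swap C2 C3 0 [Done, Done, Swap C1 C2 4 [Done, Done, Swap C0 C2 1 [Done, Swap C0 C3 0 []]]],
   Swap C2 C3 0 [Done, Done, Swap C0 C1 2 [Done, Done, Undo (Swap C1 C2 0 [])], Done, Done,
     Swap C2 C3 1 [Done, Undo Done]],
   Swap C2 C3 0 [],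
   Swap C1 C3 2 [],
   Swap C1 C3 2 [],
   Swap C1 C3 2 [Done, Done, Swap C2 C3 1 []],
   Swap C1 C2 1 [Done, Done, Done, Swap C2 C3 0 [Done, Done, Swap C1 C3 4 []]],
   Swap C2 C3 0 [Done, Done, Swap C0 C2 1 [Done, Swap C0 C3 0 []]],
   Swap C2 C3 0 [],
   Swap C1 C2 0 [Done, Swap C1 C2 5 [], Done, Done, Swap C1 C2 1 []],
   Swap C2 C3 0 [Done, Swap C2 C3 4 []],
   Swap C2 C3 0 [],
   Swap C2 C3 0 [Done, Swap C0 C1 2 [], Done, Done, Done, Swap C2 C3 1 []],
   Swap C0 C3 2 [Done, Swap C0 C2 0 []],
   Swap C2 C3 0 [],
   Swap C2 C3 0 [Done, Swap C2 C3 5 [], Done, Done, Swap C2 C3 1 []],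
   Swap C2 C3 0 [Done, Swap C1 C2 2 [], Done, Done, Swap C2 C3 1 []],
   Swap C2 C3 0 [Done, Done, Swap C1 C2 1 [Done, Swap C1 C3 2 []]],
   Swap C1 C3 3 [],
   Swap C1 C2 1 [Done, Done, Done, Swap C1 C2 0 [Done, Done, Done, Undo Done], Done, Swap C0 C3
     2 [Done, Done, Done, Undo (Swap C2 C3 1 [])]],
   Swap C0 C1 2 [Swap C1 C2 1 [Done, Done, Done, Swap C2 C3 0 [Done, Done, Swap C1 C3 4 []]]],
   Swap C2 C3 0 [Done, Done, Swap C1 C2 1 [Done, Swap C1 C3 0 []]],
   Swap C2 C3 0 [Done, Done, Swap C1 C2 1 [Done, Swap C1 C3 3 []]],
   Swap C1 C3 2 [],
   Swap C1 C2 1 [Done, Done, Swap C1 C2 0 [Done, Done, Done, Undo Done], Done, Done, Swap C0 C3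
     3 [Done, Done, Done, Undo (Swap C2 C3 1 [])]],
   Swap C0 C1 3 [Swap C1 C2 1 [Done, Done, Done, Swap C2 C3 0 [Done, Done, Swap C1 C3 4 []]]],
   Swap C2 C3 0 [Done, Done, Swap C1 C2 1 [Done, Swap C1 C3 0 []]],
   Swap C1 C3 2 [],
   Swap C1 C3 2 [],
   Swap C1 C3 2 [],
   Swap C1 C3 2 [],
   Swap C1 C3 2 [],
   Swap C1 C3 4 [Done, Done, Swap C0 C3 1 [Done, Swap C0 C2 0 []]],
   Swap C0 C2 0 [Done, Done, Done, Swap C0 C1 0 [Done, Done, Done, Swap C1 C3 0 []]],
   Swap C2 C3 0 [Done, Done, Swap C0 C1 4 [Swap C1 C3 0 [], Undo Done, Done, Undo Done], Done,
     Done, Swap C2 C3 1 [Done, Undo Done]],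
   Swap C1 C2 0 [Swap C1 C3 0 []],
   Swap C0 C1 2 [],
   Swap C2 C3 0 [Done, Done, Swap C1 C3 1 []],
   Swap C2 C3 0 [],
   Swap C1 C3 1 [Done, Swap C1 C2 0 [Done, Swap C1 C2 5 []]],
   Swap C2 C3 0 [Done, Done, Swap C1 C3 0 [Swap C0 C1 0 [Done, Done, Done, Swap C0 C3 0 []]]],
   Swap C2 C3 2 [Done, Done, Done, Done, Done, Swap C0 C3 1 [Done, Done, Swap C0 C1 1 [Done,
     Swap C1 C2 0 []]]],
   Swap C2 C3 0 [Done, Swap C2 C3 4 [Undo Done], Swap C0 C1 2 []],
   Swap C2 C3 0 [],
   Swap C2 C3 0 [Done, Swap C2 C3 5 []],
   Swap C2 C3 0 [Done, Swap C2 C3 5 []],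
   Swap C1 C3 1 [],
   Swap C2 C3 0 [],
   Swap C1 C3 1 [],
   Swap C1 C3 1 [],
   Swap C2 C3 2 [],
   Swap C1 C3 1 [Done, Swap C0 C3 2 []],
   Swap C0 C3 1 [Done, Swap C0 C2 0 []],
   Swap C1 C3 1 [Done, Swap C1 C3 4 [Swap C0 C1 1 [Done, Swap C0 C2 0 []]]],
   Swap C1 C3 1 [Done, Swap C0 C2 0 [Done, Undo (Swap C0 C3 0 [Done, Swap C0 C3 5 [], Done,
     Done, Done, Swap C0 C2 2 []])]],
   Swap C2 C3 0 [],
   Swap C2 C3 0 [Done, Swap C0 C1 2 [], Done, Done, Done, Swap C1 C2 2 []],
   Swap C0 C3 2 [Done, Done, Swap C0 C2 0 []],
   Swap C2 C3 0 [],
   Swap C2 C3 0 [Done, Swap C2 C3 5 [], Done, Done, Done, Swap C0 C1 2 []],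
   Swap C2 C3 0 [Done, Swap C2 C3 4 []],
   Swap C2 C3 0 [],
   Swap C2 C3 0 [Done, Swap C2 C3 5 [], Done, Done, Swap C2 C3 1 []],
   Swap C2 C3 0 [Done, Swap C2 C3 5 [], Done, Done, Swap C1 C2 2 []],
   Swap C2 C3 0 [Done, Done, Swap C1 C3 1 [Done, Done, Done, Swap C1 C3 0 [Done, Done, Done,
     Undo Done], Done, Swap C0 C2 2 [Done, Done, Done, Undo (Swap C2 C3 1 [])]]],
   Swap C2 C3 0 [],
   Swap C0 C3 2 [Done, Done, Swap C0 C1 3 [Done, Swap C1 C3 1 [Swap C1 C2 0 []]]],
   Swap C1 C3 1 [Done, Swap C1 C2 2 []],
   Swap C2 C3 2 [],
   Swap C2 C3 0 [Done, Swap C2 C3 4 [Undo Done], Swap C1 C2 3 []],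
   Swap C1 C3 1 [Done, Swap C1 C2 0 []],
   Swap C0 C3 1 [Done, Swap C1 C2 0 [Done, Undo (Swap C1 C3 0 [Done, Swap C1 C3 5 [], Done,
     Done, Done, Swap C0 C2 2 []])]],
   Swap C0 C3 1 [Done, Swap C0 C3 4 [Swap C0 C1 1 [Done, Swap C1 C2 0 []]]],
   Swap C2 C3 0 [Done, Done, Swap C1 C3 1 [Done, Done, Swap C1 C3 0 [Done, Done, Done, Undo
     Done], Done, Done, Swap C0 C2 3 [Done, Done, Done, Undo (Swap C2 C3 1 [])]]],
   Swap C2 C3 0 [],
   Swap C0 C3 2 [Done, Done, Swap C0 C1 2 [Done, Swap C1 C3 1 [Swap C1 C2 0 []]]],
   Swap C1 C3 1 [Done, Swap C1 C2 3 []],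
   Swap C2 C3 3 [],
   Swap C2 C3 0 [Done, Swap C2 C3 4 [Undo Done], Swap C1 C2 2 []],
   Swap C1 C3 1 [Done, Swap C1 C2 0 []],
   Swap C0 C3 1 [Done, Done, Swap C1 C2 0 [Done, Done, Undo (Swap C1 C3 0 [Done, Swap C1 C3 5
     [], Done, Done, Done, Swap C0 C2 2 []])]],
   Swap C0 C3 1 [Done, Done, Swap C0 C3 4 [Swap C0 C1 1 [Done, Swap C1 C2 0 []]]],
   Swap C1 C3 1 [],
   Swap C1 C3 1 [],
   Swap C1 C3 1 [],
   Swap C1 C3 1 [],
   Swap C1 C3 1 [],
   Swap C1 C3 1 [],
   Swap C1 C3 1 [],
   Swap C0 C3 1 [],
   Swap C1 C3 1 []]"

text \<open>A finite evaluation. Since \<open>list_all2\<close> forces equal lengths, no position is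
  left without a strategy.\<close>

lemma strategies_correct:
  "list_all2 (\<lambda>s T. check T s []) (filter (\<lambda>s. \<not> goal s) initial_states) strategies"
  by code_simp

section \<open>Kempe chains\<close>

lemma swap_colour_simps [simp]:
  "swap_colour a b a = b" "swap_colour a b b = a"
  "swap_colour a b (swap_colour a b c) = c"
  by (auto simp: swap_colour_def)

lemma swap_colour_eq_iff [simp]: "swap_colour a b c = swap_colour a b d \<longleftrightarrow> c = d"
  by (metis swap_colour_simps(3))

text \<open>This is why a state changes only at chain ends: elsewhere both colours or neither of
  them are present.\<close>

lemma swap_colour_image_trivial:
  assumes "(a \<in> S) = (b \<in> S)"
  shows "swap_colour a b ` S = S"
proof -
  have "swap_colour a b ` S \<subseteq> S"
    using assms by (auto simp: swap_colour_def)
  then show ?thesis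
    by (smt (verit) image_iff subsetD subsetI subset_antisym swap_colour_simps(3))
qed

section \<open>Edge colourings and the colours seen at a vertex\<close>

definition colouring :: "'a set set \<Rightarrow> ('a set \<Rightarrow> 'c) \<Rightarrow> bool" where
  "colouring H c \<longleftrightarrow> (\<forall>e\<in>H. \<forall>f\<in>H. e \<noteq> f \<and> e \<inter> f \<noteq> {} \<longrightarrow> c e \<noteq> c f)"

definition used :: "'a set set \<Rightarrow> ('a set \<Rightarrow> 'c) \<Rightarrow> 'a \<Rightarrow> 'c set" where
  "used H c v = c ` {e \<in> H. v \<in> e}"

lemma colouring_mono: "colouring H c \<Longrightarrow> H' \<subseteq> H \<Longrightarrow> colouring H' c"
  unfolding colouring_def by blast

lemma colouring_comp:
  assumes "colouring H c" "inj_on f (c ` H)"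
  shows "colouring H (f \<circ> c)"
  using assms unfolding colouring_def inj_on_def by auto

lemma used_comp: "used H (f \<circ> c) v = f ` used H c v"
  unfolding used_def by auto

lemma card_used:
  assumes "colouring H c"
  shows "card (used H c v) = degree H v"
  unfolding used_def degree_def
  by (rule card_image) (use assms in \<open>auto simp: colouring_def inj_on_def\<close>)

lemma degree_eq_0: "r \<notin> \<Union>H \<Longrightarrow> degree H r = 0"
  unfolding degree_def by (metis (no_types, lifting) UnionI card.empty empty_Collect_eq)

lemma used_insert:
  assumes "{p, q} \<notin> H"
  shows "used (insert {p, q} H) (c({p, q} := m)) r =
    (if r = p \<or> r = q then insert m (used H c r) else used H c r)"
  using assms unfolding used_def by (auto simp: image_iff)

lemma colouring_insert:
  assumes "colouring H c" "{p, q} \<notin> H" "m \<notin> used H c p" "m \<notin> used H c q"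
  shows "colouring (insert {p, q} H) (c({p, q} := m))"
  using assms unfolding colouring_def used_def by (auto simp: image_iff)

text \<open>A union of components of the subgraph of edges coloured \<open>a\<close> or
  \<open>b\<close>. Several components are allowed, as a recorded link need not stand for a single
  chain.\<close>

definition closed :: "'a set set \<Rightarrow> ('a set \<Rightarrow> colour) \<Rightarrow> colour \<Rightarrow> colour \<Rightarrow> 'a set set \<Rightarrow> bool" where
  "closed H c a b M \<longleftrightarrow> M \<subseteq> {e \<in> H. c e \<in> {a, b}} \<and>
     (\<forall>e\<in>M. \<forall>f\<in>H. c f \<in> {a, b} \<and> e \<inter> f \<noteq> {} \<longrightarrow> f \<in> M)"

definition swap_on :: "colour \<Rightarrow> colour \<Rightarrow> 'a set set \<Rightarrow> ('a set \<Rightarrow> colour) \<Rightarrow> 'a set \<Rightarrow> colour" where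
  "swap_on a b M c e = (if e \<in> M then swap_colour a b (c e) else c e)"

lemma colouring_swap_on:
  assumes "colouring H c" "closed H c a b M"
  shows "colouring H (swap_on a b M c)"
  unfolding colouring_def
proof (intro ballI impI)
  fix e f assume ef: "e \<in> H" "f \<in> H" "e \<noteq> f \<and> e \<inter> f \<noteq> {}"
  then have ne: "c e \<noteq> c f" using assms(1) unfolding colouring_def by blast
  \<comment> \<open>On the border of \<open>M\<close> the inner edge keeps a colour in
    \<open>{a, b}\<close>, while closedness gives the outer edge a colour outside that set.\<close>
  have *: "swap_colour a b (c g) \<noteq> c h"
    if "g \<in> M" "h \<notin> M" "g \<inter> h \<noteq> {}" "h \<in> H" for g h
  proof -
    have "c g \<in> {a, b}" "c h \<notin> {a, b}"
      using assms(2) that unfolding closed_def by auto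
    then show ?thesis by (auto simp: swap_colour_def)
  qed
  show "swap_on a b M c e \<noteq> swap_on a b M c f"
    using *[of e f] *[of f e] ef ne
    by (cases "e \<in> M"; cases "f \<in> M") (auto simp: swap_on_def Int_commute)
qed

lemma used_swap_on:
  assumes "closed H c a b M"
  shows "used H (swap_on a b M c) r =
    (if r \<in> \<Union>M then swap_colour a b ` used H c r else used H c r)"
proof (cases "r \<in> \<Union>M")
  case True
  then obtain e where e: "e \<in> M" "r \<in> e" by blast
  \<comment> \<open>At a covered vertex every edge coloured \<open>a\<close> or \<open>b\<close>
    lies in \<open>M\<close>, and the exchange fixes all other colours.\<close>
  have "swap_on a b M c f = swap_colour a b (c f)" if f: "f \<in> H" "r \<in> f" for f
  proof (cases "f \<in> M")
    case False
    then have "c f \<notin> {a, b}"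
      using assms e f unfolding closed_def by blast
    then show ?thesis using False by (auto simp: swap_on_def swap_colour_def)
  qed (simp add: swap_on_def)
  then have "used H (swap_on a b M c) r = (\<lambda>f. swap_colour a b (c f)) ` {f \<in> H. r \<in> f}"
    unfolding used_def by (intro image_cong) auto
  then show ?thesis using True by (simp add: used_def image_image)
next
  case False
  then have "swap_on a b M c f = c f" if "f \<in> H" "r \<in> f" for f
    using that by (auto simp: swap_on_def)
  then have "used H (swap_on a b M c) r = c ` {f \<in> H. r \<in> f}"
    unfolding used_def by (intro image_cong) auto
  then show ?thesis using False by (simp add: used_def)
qed

text \<open>For the same or the disjoint pair, the exchange maps \<open>{a', b'}\<close> to itself,
  so the edges with these colours remain the same ones.\<close>

lemma closed_swap_on:
  assumes "closed H c a' b' N" "compatible a b (a', b', i, j)" "closed H c a b M"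
  shows "closed H (swap_on a b M c) a' b' N"
proof -
  have "swap_on a b M c e \<in> {a', b'} \<longleftrightarrow> c e \<in> {a', b'}" for e
  proof (cases "e \<in> M")
    case True
    then have "c e \<in> {a, b}" using assms(3) unfolding closed_def by auto
    then show ?thesis
      using True assms(2) by (auto simp: swap_on_def compatible_def swap_colour_def)
  qed (simp add: swap_on_def)
  then show ?thesis using assms(1) unfolding closed_def by auto
qed

text \<open>Grow \<open>M\<close> from \<open>{e0}\<close> one adjacent edge at a time: in a graph of maximum degree 2 the
  number of vertices lying on exactly one edge of \<open>M\<close> never exceeds 2.\<close>

lemma two_ended_component:
  fixes F :: "'a set set"
  assumes fin: "finite F" and two: "\<And>e. e \<in> F \<Longrightarrow> card e = 2"
    and deg: "\<And>r. degree F r \<le> 2" and e0: "e0 \<in> F"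
  obtains M where "M \<subseteq> F" "e0 \<in> M" "\<And>e f. e \<in> M \<Longrightarrow> f \<in> F \<Longrightarrow> e \<inter> f \<noteq> {} \<Longrightarrow> f \<in> M"
    "card {r. degree M r = 1} \<le> 2"
proof -
  define ends where "ends M = {r. degree M r = 1}" for M :: "'a set set"
  define P where "P M \<longleftrightarrow> M \<subseteq> F \<and> e0 \<in> M \<and> card (ends M) \<le> 2" for M
  have ends0: "r \<in> \<Union>M" if "r \<in> ends M" for M r
    using that degree_eq_0[of r M] by (force simp: ends_def)
  have "ends {e0} \<subseteq> e0" using ends0 by force
  moreover have "finite e0" "card e0 = 2" using two[OF e0] card.infinite by force+
  ultimately have "card (ends {e0}) \<le> 2" by (metis card_mono)
  then have "P {e0}" using e0 by (simp add: P_def)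
  moreover have "M \<in> Pow F" if "P M" for M using that by (simp add: P_def)
  moreover have "finite (Pow F)" using fin by simp
  \<comment> \<open>Take \<open>M\<close> maximal under \<open>P\<close>. If an adjacent edge of
    \<open>F\<close> were missing, adding it would preserve \<open>P\<close>; so \<open>M\<close>
    absorbs all of them.\<close>
  ultimately obtain M where M: "P M" and max: "\<And>M'. P M' \<Longrightarrow> M \<subseteq> M' \<Longrightarrow> M' = M"
    using finite_has_maximal2[of "Collect P" "{e0}"]
    by (metis (no_types, lifting) finite_subset mem_Collect_eq subsetI)
  have finM: "finite M" using M fin finite_subset unfolding P_def by blast
  have "finite e" if "e \<in> F" for e using two[OF that] card.infinite by force
  then have finU: "finite (\<Union>M)" using M finM unfolding P_def by blast
  have "f \<in> M" if e: "e \<in> M" and f: "f \<in> F" and ne: "e \<inter> f \<noteq> {}" for e f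
  proof (rule ccontr)
    assume fM: "f \<notin> M"
    obtain r where r: "r \<in> e" "r \<in> f" using ne by blast
    obtain r' where r': "f = {r, r'}"
      using two[OF f] r(2) by (auto simp: card_2_iff)
    have eF: "e \<in> F" using e M unfolding P_def by blast
    have "{e, f} \<subseteq> {g \<in> F. r \<in> g}" using eF f r by auto
    moreover have card2: "card {e, f} = 2" using e fM by (metis card_2_iff)
    moreover have "finite {g \<in> F. r \<in> g}" using fin by simp
    \<comment> \<open>The degree bound leaves no third edge at \<open>r\<close>. Hence
      \<open>r\<close> is an end of \<open>M\<close> that adding \<open>f\<close> removes, while at
      most \<open>r'\<close> becomes a new end.\<close>
    ultimately have ef: "{g \<in> F. r \<in> g} = {e, f}"
      using deg[of r] unfolding degree_def by (metis card_seteq)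
    have "{g \<in> M. r \<in> g} = {e}" using ef e r fM M unfolding P_def by blast
    then have rM: "r \<in> ends M" by (simp add: ends_def degree_def)
    have "{g \<in> insert f M. r \<in> g} = {e, f}" using ef e r f M unfolding P_def by blast
    then have rn: "r \<notin> ends (insert f M)"
      using card2 by (simp add: ends_def degree_def)
    have "ends (insert f M) \<subseteq> insert r' (ends M - {r})"
    proof
      fix k assume k: "k \<in> ends (insert f M)"
      then have "k \<noteq> r" using rn by blast
      moreover have "k \<in> ends M" if "k \<noteq> r'"
      proof -
        have "{g \<in> insert f M. k \<in> g} = {g \<in> M. k \<in> g}"
          using that \<open>k \<noteq> r\<close> r' by auto
        then show ?thesis using k by (simp add: ends_def degree_def)
      qed
      ultimately show "k \<in> insert r' (ends M - {r})" by blast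
    qed
    moreover have finE: "finite (ends M)" using ends0 finU by (meson finite_subset subsetI)
    ultimately have "card (ends (insert f M)) \<le> card (insert r' (ends M - {r}))"
      by (intro card_mono) auto
    also have "\<dots> \<le> Suc (card (ends M - {r}))" using finE by (simp add: card_insert_if)
    also have "\<dots> = card (ends M)" using finE rM by (rule card_Suc_Diff1)
    finally have "P (insert f M)" using M f unfolding P_def by auto
    then show False using max[of "insert f M"] fM by blast
  qed
  then show thesis using that M unfolding P_def ends_def by blast
qed

text \<open>\<open>M\<close> is a single chain, so a closed set \<open>N\<close> missing its end \<open>i\<close> misses all of it: this is why
  the ends of known links can be excluded as other ends.\<close>

lemma kempe_chain:
  fixes H :: "'a set set"
  assumes fin: "finite H" and two: "\<And>e. e \<in> H \<Longrightarrow> card e = 2" and col: "colouring H c"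
    and i: "(a \<in> used H c i) \<noteq> (b \<in> used H c i)"
  obtains M where "closed H c a b M" "i \<in> \<Union>M"
    "\<forall>N. closed H c a b N \<longrightarrow> i \<notin> \<Union>N \<longrightarrow> \<Union>M \<inter> \<Union>N = {}"
    "finite {r \<in> \<Union>M. (a \<in> used H c r) \<noteq> (b \<in> used H c r)}"
    "card {r \<in> \<Union>M. (a \<in> used H c r) \<noteq> (b \<in> used H c r)} \<le> 2"
proof -
  define F where "F = {e \<in> H. c e \<in> {a, b}}"
  have inj: "inj_on c {e \<in> F. r \<in> e}" for r
    using col unfolding F_def colouring_def inj_on_def by blast
  have img: "c ` {e \<in> F. r \<in> e} = used H c r \<inter> {a, b}" for r
    unfolding F_def used_def by auto
  \<comment> \<open>Edges at one vertex have different colours, so the degree in \<open>F\<close>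
    counts which of \<open>a\<close>, \<open>b\<close> are used there.\<close>
  have degF: "degree F r = card (used H c r \<inter> {a, b})" for r
    unfolding degree_def img[symmetric] by (rule card_image[OF inj, symmetric])
  have degF2: "degree F r \<le> 2" for r
  proof -
    have "card (used H c r \<inter> {a, b}) \<le> card {a, b}" by (intro card_mono) auto
    also have "\<dots> \<le> 2" by (simp add: card_insert_if)
    finally show ?thesis by (simp add: degF)
  qed
  have finF: "finite F" using fin by (simp add: F_def)
  have twoF: "\<And>e. e \<in> F \<Longrightarrow> card e = 2" using two by (simp add: F_def)
  obtain e0 where e0: "e0 \<in> F" "i \<in> e0"
    using i unfolding used_def F_def by auto
  obtain M0 where M0: "M0 \<subseteq> F" "e0 \<in> M0"
    "\<And>e f. e \<in> M0 \<Longrightarrow> f \<in> F \<Longrightarrow> e \<inter> f \<noteq> {} \<Longrightarrow> f \<in> M0" "card {r. degree M0 r = 1} \<le> 2"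
    using two_ended_component[OF finF twoF degF2 e0(1)] by blast
  have clos0: "closed H c a b M0"
    using M0(1,3) unfolding closed_def F_def by blast
  \<comment> \<open>\<open>M0\<close> bounds the number of ends; the least closed set containing
    \<open>e0\<close> lies inside \<open>M0\<close>, and its minimality yields disjointness from
    other closed sets.\<close>
  define M where "M = \<Inter>{N. closed H c a b N \<and> e0 \<in> N}"
  have M_sub: "M \<subseteq> N" if "closed H c a b N" "e0 \<in> N" for N
    using that by (auto simp: M_def)
  have closM: "closed H c a b M"
    unfolding closed_def
  proof (intro conjI ballI impI)
    show "M \<subseteq> {e \<in> H. c e \<in> {a, b}}"
      using M_sub[OF clos0 M0(2)] M0(1) unfolding F_def by (rule subset_trans)
  next
    fix e f assume ef: "e \<in> M" "f \<in> H" "c f \<in> {a, b} \<and> e \<inter> f \<noteq> {}"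
    have "f \<in> N" if "closed H c a b N" "e0 \<in> N" for N
    proof -
      have "e \<in> N" using M_sub[OF that] ef(1) by (rule subsetD)
      then show ?thesis using that(1) ef(2,3) unfolding closed_def by auto
    qed
    then show "f \<in> M" by (simp add: M_def)
  qed
  have e0M: "e0 \<in> M" by (simp add: M_def)
  have disj: "\<Union>M \<inter> \<Union>N = {}" if N: "closed H c a b N" "i \<notin> \<Union>N" for N
  proof -
    \<comment> \<open>Removing \<open>N\<close> keeps \<open>e0\<close>, as \<open>N\<close> does
      not cover \<open>i\<close>. By minimality nothing was removed.\<close>
    have "closed H c a b (M - N)"
      unfolding closed_def
    proof (intro conjI ballI impI)
      show "M - N \<subseteq> {e \<in> H. c e \<in> {a, b}}" using closM unfolding closed_def by blast
    next
      fix e f assume ef: "e \<in> M - N" "f \<in> H" "c f \<in> {a, b} \<and> e \<inter> f \<noteq> {}"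
      have "e \<in> H" "c e \<in> {a, b}" using ef closM unfolding closed_def by blast+
      moreover have "f \<inter> e \<noteq> {}" using ef by blast
      ultimately have "f \<notin> N" using ef N(1) unfolding closed_def by blast
      moreover have "f \<in> M" using ef closM unfolding closed_def by blast
      ultimately show "f \<in> M - N" by blast
    qed
    moreover have "e0 \<in> M - N" using e0 e0M N(2) by blast
    ultimately have MN: "M \<inter> N = {}" using M_sub by blast
    show ?thesis
    proof (rule ccontr)
      assume "\<Union>M \<inter> \<Union>N \<noteq> {}"
      then obtain e f where ef: "e \<in> M" "f \<in> N" "e \<inter> f \<noteq> {}" by blast
      then have "f \<in> M" using closM N(1) unfolding closed_def by blast
      then show False using ef(2) MN by blast
    qed
  qed
  have sub: "{r \<in> \<Union>M. (a \<in> used H c r) \<noteq> (b \<in> used H c r)} \<subseteq> {r. degree M0 r = 1}"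
  proof (rule subsetI, clarify)
    fix r e assume r: "e \<in> M" "r \<in> e" "(a \<in> used H c r) \<noteq> (b \<in> used H c r)"
    \<comment> \<open>Only one edge of \<open>F\<close> meets such a vertex, so this is also its
      only edge in \<open>M0\<close>.\<close>
    then have "used H c r \<inter> {a, b} = {a} \<or> used H c r \<inter> {a, b} = {b}" by auto
    then have "degree F r = 1" by (auto simp: degF)
    then obtain g where g: "{e \<in> F. r \<in> e} = {g}"
      unfolding degree_def by (auto simp: card_1_singleton_iff)
    have eq_g: "k = g" if "k \<in> M0" "r \<in> k" for k
    proof -
      have "k \<in> {e \<in> F. r \<in> e}" using that M0(1) by auto
      then show ?thesis by (simp add: g)
    qed
    have "e \<in> M0" using M_sub[OF clos0 M0(2)] r(1) by (rule subsetD)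
    then have "{e \<in> M0. r \<in> e} = {g}" using eq_g r(2) by auto
    then show "degree M0 r = 1" by (simp add: degree_def)
  qed
  have "{r. degree M0 r = 1} \<subseteq> \<Union>M0"
  proof
    fix r assume "r \<in> {r. degree M0 r = 1}"
    then show "r \<in> \<Union>M0" using degree_eq_0[of r M0] by (cases "r \<in> \<Union>M0") simp_all
  qed
  moreover have "finite (\<Union>M0)"
  proof (rule finite_Union)
    show "finite M0" using clos0 fin unfolding closed_def by (auto intro: finite_subset)
    fix e assume "e \<in> M0"
    then have "card e = 2" using two clos0 unfolding closed_def by auto
    then show "finite e" using card.infinite by force
  qed
  ultimately have fin0: "finite {r. degree M0 r = 1}" by (rule finite_subset)
  show thesis
  proof (rule that)
    show "closed H c a b M" by fact
    show "i \<in> \<Union>M" using e0 e0M by blast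
    show "\<forall>N. closed H c a b N \<longrightarrow> i \<notin> \<Union>N \<longrightarrow> \<Union>M \<inter> \<Union>N = {}"
      using disj by blast
    show "finite {r \<in> \<Union>M. (a \<in> used H c r) \<noteq> (b \<in> used H c r)}"
      using sub fin0 by (rule finite_subset)
    show "card {r \<in> \<Union>M. (a \<in> used H c r) \<noteq> (b \<in> used H c r)} \<le> 2"
      using card_mono[OF fin0 sub] M0(4) by linarith
  qed
qed

section \<open>Soundness of the strategies\<close>

lemma mem_swap_colour_image: "d \<in> swap_colour a b ` S \<longleftrightarrow> swap_colour a b d \<in> S"
  by (metis image_iff swap_colour_simps(3))

lemma set_swap_ends:
  assumes "m < length s"
  shows "set (swap_ends a b i j s ! m) =
    (if m = i \<or> m = j then swap_colour a b ` set (s ! m) else set (s ! m))"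
  using assms by (auto simp: swap_ends_def swap_at_def nth_list_update)

lemma length_swap_ends [simp]: "length (swap_ends a b i j s) = length s"
  by (simp add: swap_ends_def swap_at_def)

text \<open>A disjoint pair is not touched by the exchange; for the same pair the two memberships
  trade places, and being an end is symmetric in them.\<close>

lemma chain_end_swap_ends:
  assumes "m < length s" "compatible a b (a', b', k, l)"
  shows "chain_end a' b' (swap_ends a b i j s ! m) \<longleftrightarrow> chain_end a' b' (s ! m)"
  using assms
  by (auto simp: chain_end_def set_swap_ends mem_swap_colour_image compatible_def swap_colour_def)

locale kempe_state =
  fixes H :: "'a set set" and vs :: "'a list"
  assumes finite_edges: "finite H"
    and card_edge: "e \<in> H \<Longrightarrow> card e = 2"
    and distinct_vs: "distinct vs"
begin

definition represents :: "('a set \<Rightarrow> colour) \<Rightarrow> state \<Rightarrow> bool" where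
  "represents c s \<longleftrightarrow> colouring H c \<and> length s = length vs \<and>
     (\<forall>m<length vs. set (s ! m) = used H c (vs ! m))"

text \<open>\<open>M\<close> is prescribed only at listed vertices that are chain ends, since at the
  others the exchange leaves the colour set unchanged anyway.\<close>

definition link_ok :: "('a set \<Rightarrow> colour) \<Rightarrow> state \<Rightarrow> link \<Rightarrow> bool" where
  "link_ok c s l = (case l of (a, b, i, j) \<Rightarrow> \<exists>M. closed H c a b M \<and>
     (\<forall>m<length vs. chain_end a b (s ! m) \<longrightarrow> (vs ! m \<in> \<Union>M \<longleftrightarrow> m = i \<or> m = j)))"

lemma represents_swap:
  assumes rep: "represents c s" and M: "closed H c a b M"
    and ends: "\<And>m. m < length vs \<Longrightarrow> chain_end a b (s ! m) \<Longrightarrow> vs ! m \<in> \<Union>M \<longleftrightarrow> m = i \<or> m = j"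
  shows "represents (swap_on a b M c) (swap_ends a b i j s)"
proof -
  have "set (swap_ends a b i j s ! m) = used H (swap_on a b M c) (vs ! m)"
    if m: "m < length vs" for m
  proof (cases "chain_end a b (s ! m)")
    case True
    then show ?thesis
      using rep m ends[OF m True] by (simp add: represents_def set_swap_ends used_swap_on[OF M])
  next
    case False
    then have "swap_colour a b ` set (s ! m) = set (s ! m)"
      by (intro swap_colour_image_trivial) (simp add: chain_end_def)
    then show ?thesis
      using rep m by (simp add: represents_def set_swap_ends used_swap_on[OF M])
  qed
  then show ?thesis
    using rep colouring_swap_on[OF _ M] by (simp add: represents_def)
qed

lemma link_ok_swap:
  assumes "link_ok c s l" "compatible a b l" "closed H c a b M" "length s = length vs"
  shows "link_ok (swap_on a b M c) (swap_ends a b i j s) l"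
proof -
  obtain a' b' k k' where l: "l = (a', b', k, k')" by (cases l)
  obtain N where "closed H c a' b' N"
    "\<forall>m<length vs. chain_end a' b' (s ! m) \<longrightarrow> (vs ! m \<in> \<Union>N \<longleftrightarrow> m = k \<or> m = k')"
    using assms(1) by (auto simp: link_ok_def l)
  then show ?thesis
    using assms closed_swap_on[of H c a' b' N a b k k' M] chain_end_swap_ends[of _ s a b a' b' k k' i j]
    unfolding link_ok_def l by auto
qed

text \<open>The common core of a move and of its reversal: both recolour along a valid link, which
  stays valid because it is compatible with its own pair.\<close>

lemma swap_linked:
  assumes "represents c s" "\<forall>l\<in>set K. link_ok c s l" "\<forall>l\<in>set K. compatible a b l"
    and "link_ok c s (a, b, i, j)"
  shows "\<exists>c'. represents c' (swap_ends a b i j s) \<and>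
    (\<forall>l\<in>set ((a, b, i, j) # K). link_ok c' (swap_ends a b i j s) l)"
proof -
  obtain M where M: "closed H c a b M"
    "\<And>m. m < length vs \<Longrightarrow> chain_end a b (s ! m) \<Longrightarrow> vs ! m \<in> \<Union>M \<longleftrightarrow> m = i \<or> m = j"
    using assms(4) by (auto simp: link_ok_def)
  have len: "length s = length vs" using assms(1) by (simp add: represents_def)
  have "compatible a b (a, b, i, j)" by (simp add: compatible_def)
  then have "\<forall>l\<in>set ((a, b, i, j) # K). link_ok (swap_on a b M c) (swap_ends a b i j s) l"
    using assms(2-4) link_ok_swap[OF _ _ M(1) len] by auto
  then show ?thesis
    using represents_swap[OF assms(1) M] by blast
qed

text \<open>The adversary has a legal answer: the chain from \<open>i\<close> has at most two ends,
  and it is disjoint from the closed set of any recorded link for this pair, because such a set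
  misses \<open>i\<close>.\<close>

lemma open_end_linked:
  assumes rep: "represents c s" and K: "\<forall>l\<in>set K. link_ok c s l"
    and i: "i \<in> set (open_ends a b s K)"
  shows "\<exists>j\<in>set (open_ends a b s K). link_ok c s (a, b, i, j)"
proof -
  have len: "length s = length vs" using rep by (simp add: represents_def)
  have end_iff: "chain_end a b (s ! m) \<longleftrightarrow> (a \<in> used H c (vs ! m)) \<noteq> (b \<in> used H c (vs ! m))"
    if "m < length vs" for m
    using rep that by (simp add: represents_def chain_end_def)
  have i': "i < length vs" "chain_end a b (s ! i)" "\<not> linked a b K i"
    using i len by (auto simp: open_ends_def)
  have col: "colouring H c" using rep by (simp add: represents_def)
  have end_i: "(a \<in> used H c (vs ! i)) \<noteq> (b \<in> used H c (vs ! i))"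
    using i' end_iff by blast
  obtain M where M: "closed H c a b M" "vs ! i \<in> \<Union>M"
    and disj: "\<forall>N. closed H c a b N \<longrightarrow> vs ! i \<notin> \<Union>N \<longrightarrow> \<Union>M \<inter> \<Union>N = {}"
    and fin: "finite {r \<in> \<Union>M. (a \<in> used H c r) \<noteq> (b \<in> used H c r)}"
    and card: "card {r \<in> \<Union>M. (a \<in> used H c r) \<noteq> (b \<in> used H c r)} \<le> 2"
    by (rule kempe_chain[OF finite_edges card_edge col end_i])
  define I where "I = {m. m < length vs \<and> chain_end a b (s ! m) \<and> vs ! m \<in> \<Union>M}"
  have inj: "inj_on ((!) vs) I"
    using distinct_vs by (auto simp: I_def inj_on_def nth_eq_iff_index_eq)
  have sub: "(!) vs ` I \<subseteq> {r \<in> \<Union>M. (a \<in> used H c r) \<noteq> (b \<in> used H c r)}"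
    using end_iff by (auto simp: I_def)
  have cardI: "card I \<le> 2"
    using card_mono[OF fin sub] card card_image[OF inj] by linarith
  have iI: "i \<in> I" using i' M(2) by (simp add: I_def)
  have finI: "finite I" by (simp add: I_def)
  \<comment> \<open>\<open>I\<close> contains \<open>i\<close> and has at most two elements;
    \<open>j = i\<close> encodes that no other listed vertex is an end.\<close>
  obtain j where j: "I = {i, j}"
  proof (cases "I = {i}")
    case True
    then show thesis using that[of i] by simp
  next
    case False
    then obtain j where "j \<in> I" "j \<noteq> i" using iI by blast
    then have "{i, j} = I"
      using iI finI cardI by (intro card_seteq) (simp_all add: eq_commute)
    then show thesis using that by blast
  qed
  have link: "link_ok c s (a, b, i, j)"
    unfolding link_ok_def prod.case
  proof (intro exI[of _ M] conjI allI impI)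
    fix m assume "m < length vs" "chain_end a b (s ! m)"
    then have "vs ! m \<in> \<Union>M \<longleftrightarrow> m \<in> I" by (simp add: I_def)
    then show "vs ! m \<in> \<Union>M \<longleftrightarrow> m = i \<or> m = j" by (simp add: j)
  qed (fact M(1))
  have jI: "j \<in> I" by (simp add: j)
  then have j': "j < length vs" "chain_end a b (s ! j)" "vs ! j \<in> \<Union>M" by (auto simp: I_def)
  have "\<not> linked a b K j"
  proof
    assume "linked a b K j"
    then obtain k k' where k: "(a, b, k, k') \<in> set K" "j = k \<or> j = k'"
      by (auto simp: linked_def list_ex_iff)
    then obtain N where N: "closed H c a b N"
      "\<And>m. m < length vs \<Longrightarrow> chain_end a b (s ! m) \<Longrightarrow> vs ! m \<in> \<Union>N \<longleftrightarrow> m = k \<or> m = k'"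
      using K by (fastforce simp: link_ok_def)
    have "i \<noteq> k \<and> i \<noteq> k'" using i'(3) k(1) by (auto simp: linked_def list_ex_iff)
    then have "vs ! i \<notin> \<Union>N" using N(2) i' by blast
    then have "vs ! j \<notin> \<Union>N" using disj N(1) j'(3) by blast
    then show False using N(2)[OF j'(1,2)] k(2) by blast
  qed
  then have "j \<in> set (open_ends a b s K)" using j' len by (simp add: open_ends_def)
  then show ?thesis using link by blast
qed

text \<open>Induction over the strategy, for all states and links at once:
  \<open>open_end_linked\<close> supplies the adversary's answer and \<open>swap_linked\<close> the
  recolouring.\<close>

lemma check_sound:
  assumes "check T s K" "represents c s" "\<forall>l\<in>set K. link_ok c s l"
  shows "\<exists>c' s'. represents c' s' \<and> goal s'"
  using assms
proof (induction T arbitrary: s K c)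
  case Done
  then show ?case by auto
next
  case (Undo T)
  obtain l a b i j K' where K: "K = l # (a, b, i, j) # K'"
    and T: "check T (swap_ends a b i j s) (filter (compatible a b) K)"
    using Undo.prems(1) by (auto split: list.splits)
  define L where "L = filter (compatible a b) K"
  have L: "\<forall>l\<in>set L. link_ok c s l" "\<forall>l\<in>set L. compatible a b l"
    using Undo.prems(3) by (simp_all add: L_def)
  have "link_ok c s (a, b, i, j)" using Undo.prems(3) by (simp add: K)
  then obtain c' where "represents c' (swap_ends a b i j s)"
    "\<forall>l\<in>set ((a, b, i, j) # L). link_ok c' (swap_ends a b i j s) l"
    using swap_linked[OF Undo.prems(2) L] by blast
  then have "represents c' (swap_ends a b i j s)"
    "\<forall>l\<in>set (filter (compatible a b) K). link_ok c' (swap_ends a b i j s) l"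
    by (simp_all add: L_def)
  then show ?case using Undo.IH[OF T] by blast
next
  case (Swap a b i Ts)
  define K' where "K' = filter (compatible a b) K"
  define js where "js = open_ends a b s K'"
  define tests where "tests = map check Ts @ replicate (length js) (\<lambda>s K. goal s)"
  have i: "i \<in> set js"
    and tests: "list_all (\<lambda>(j, test). test (swap_ends a b i j s) ((a, b, i, j) # K')) (zip js tests)"
    using Swap.prems(1) by (simp_all add: Let_def K'_def js_def tests_def)
  have K': "\<forall>l\<in>set K'. link_ok c s l" "\<forall>l\<in>set K'. compatible a b l"
    using Swap.prems(3) by (auto simp: K'_def)
  obtain j where j: "j \<in> set js" "link_ok c s (a, b, i, j)"
    using open_end_linked[OF Swap.prems(2) K'(1)] i unfolding js_def by blast
  obtain c' where c': "represents c' (swap_ends a b i j s)"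
    "\<forall>l\<in>set ((a, b, i, j) # K'). link_ok c' (swap_ends a b i j s) l"
    using swap_linked[OF Swap.prems(2) K' j(2)] by blast
  obtain n where n: "n < length js" "js ! n = j" using j(1) by (auto simp: in_set_conv_nth)
  have lt: "length js \<le> length tests" by (simp add: tests_def)
  then have "(j, tests ! n) \<in> set (zip js tests)"
    using n by (auto simp: set_zip intro!: exI[of _ n])
  then have test: "(tests ! n) (swap_ends a b i j s) ((a, b, i, j) # K')"
    using tests by (auto simp: list_all_iff)
  show ?case
  proof (cases "n < length Ts")
    case True
    then have "check (Ts ! n) (swap_ends a b i j s) ((a, b, i, j) # K')"
      using test by (simp add: tests_def nth_append)
    then show ?thesis using Swap.IH[of "Ts ! n"] True c' by (meson nth_mem)
  next
    \<comment> \<open>Past the end of \<open>Ts\<close> the test is the padding, which demands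
      \<open>goal\<close> at once.\<close>
    case False
    then have "goal (swap_ends a b i j s)"
      using test n by (simp add: tests_def nth_append)
    then show ?thesis using c'(1) by blast
  qed
qed

lemma initial_state_sound:
  assumes "represents c s" "s \<in> set initial_states"
  shows "\<exists>c' s'. represents c' s' \<and> goal s'"
proof (cases "goal s")
  case False
  then have "s \<in> set (filter (\<lambda>s. \<not> goal s) initial_states)" using assms(2) by simp
  then obtain T where "check T s []"
    using strategies_correct by (metis in_set_conv_nth list_all2_nthD)
  then show ?thesis using check_sound[OF _ assms(1)] by simp
qed (use assms in blast)

end

section \<open>Extending the colouring to the double star\<close>

lemma ex_colour_pair:
  assumes "card (S :: colour set) = 2"
  shows "\<exists>P\<in>set colour_pairs. set P = S"
proof -
  obtain a b where S: "S = {a, b}" "a \<noteq> b" using assms by (auto simp: card_2_iff)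
  have "\<exists>P\<in>set colour_pairs. set P = {a, b}"
    using S(2) by (cases a; cases b) (simp_all add: colour_pairs_def doubleton_eq_iff)
  then show ?thesis by (simp add: S)
qed

lemma colouring_neq:
  assumes "colouring H c" "e \<in> H" "f \<in> H" "r \<in> e" "r \<in> f" "e \<noteq> f"
  shows "c e \<noteq> c f"
  using assms unfolding colouring_def by blast

lemma used_avoids:
  assumes "colouring G c" "t \<in> G" "r \<in> t" "H \<subseteq> G" "t \<notin> H"
  shows "c t \<notin> used H c r"
proof
  assume "c t \<in> used H c r"
  then obtain e where "e \<in> H" "r \<in> e" "c t = c e" by (auto simp: used_def)
  then show False using colouring_neq[OF assms(1), of t e r] assms by auto
qed

text \<open>Needed for the injectivity of the colour renaming, whose last case must be hit by a
  single colour.\<close>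

lemma fourth_nat_unique:
  fixes m n p i j :: nat
  assumes "m < 4" "n < 4" "p < 4" "i < 4" "j < 4" "distinct [m, n, p, i]" "distinct [m, n, p, j]"
  shows "i = j"
proof -
  have "{m, n, p, j} = {..<4}"
    by (rule card_subset_eq) (use assms in auto)
  then have "i \<in> {m, n, p, j}" using assms(4) by simp
  then show ?thesis using assms(6) by auto
qed

lemma degree_Diff:
  assumes "finite E" "{t \<in> T. r \<in> t} = A" "A \<subseteq> E"
  shows "degree (E - T) r = degree E r - card A"
proof -
  have A: "t \<in> A \<longleftrightarrow> t \<in> T \<and> r \<in> t" for t using assms(2) by blast
  have "{e \<in> E - T. r \<in> e} = {e \<in> E. r \<in> e} - A" using A by auto
  moreover have "A \<subseteq> {e \<in> E. r \<in> e}" using A assms(3) by auto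
  moreover have "finite A" using assms(1,3) by (rule finite_subset[rotated])
  ultimately show ?thesis
    unfolding degree_def by (simp add: card_Diff_subset)
qed

lemma goal_extends:
  assumes d: "distinct [x, y, z, u, v, w]" and col: "colouring H c"
    and notin: "{x, y} \<notin> H" "{y, z} \<notin> H" "{y, v} \<notin> H" "{v, u} \<notin> H" "{v, w} \<notin> H"
    and s: "goal s" "set (s ! 0) = used H c y" "set (s ! 1) = used H c v" "set (s ! 2) = used H c x"
      "set (s ! 3) = used H c z" "set (s ! 4) = used H c u" "set (s ! 5) = used H c w"
  shows "\<exists>c' :: 'a set \<Rightarrow> colour. colouring (insert {x, y} (insert {y, z} (insert {y, v} (insert {v, u} (insert {v, w} H))))) c'"
proof -
  \<comment> \<open>\<open>m\<close> is for \<open>yv\<close>, \<open>i\<close> for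
    \<open>xy\<close>, \<open>j\<close> for \<open>yz\<close>, \<open>k\<close> for
    \<open>vu\<close>, \<open>l\<close> for \<open>vw\<close>. The edges are then added one at a
    time, each colour being checked at both ends.\<close>
  obtain m i j k l where
    m: "m \<notin> used H c y" "m \<notin> used H c v" and
    y: "i \<noteq> m" "i \<notin> used H c y" "i \<notin> used H c x" "j \<noteq> m" "j \<noteq> i" "j \<notin> used H c y" "j \<notin> used H c z" and
    v: "k \<noteq> m" "k \<notin> used H c v" "k \<notin> used H c u" "l \<noteq> m" "l \<noteq> k" "l \<notin> used H c v" "l \<notin> used H c w"
    using s(1) unfolding goal_def side_ok_def list_ex_iff s(2-7) by blast
  define H1 c1 where "H1 = insert {v, w} H" and "c1 = c({v, w} := l)"
  define H2 c2 where "H2 = insert {v, u} H1" and "c2 = c1({v, u} := k)"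
  define H3 c3 where "H3 = insert {y, v} H2" and "c3 = c2({y, v} := m)"
  define H4 c4 where "H4 = insert {y, z} H3" and "c4 = c3({y, z} := j)"
  have n2: "{v, u} \<notin> H1" and n3: "{y, v} \<notin> H2" and n4: "{y, z} \<notin> H3" and n5: "{x, y} \<notin> H4"
    using d notin by (auto simp: H1_def H2_def H3_def H4_def doubleton_eq_iff)
  have u1: "used H1 c1 r = (if r = v \<or> r = w then insert l (used H c r) else used H c r)" for r
    unfolding H1_def c1_def by (rule used_insert) (rule notin)
  have u2: "used H2 c2 r = (if r = v \<or> r = u then insert k (used H1 c1 r) else used H1 c1 r)" for r
    unfolding H2_def c2_def by (rule used_insert) (rule n2)
  have u3: "used H3 c3 r = (if r = y \<or> r = v then insert m (used H2 c2 r) else used H2 c2 r)" for r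
    unfolding H3_def c3_def by (rule used_insert) (rule n3)
  have u4: "used H4 c4 r = (if r = y \<or> r = z then insert j (used H3 c3 r) else used H3 c3 r)" for r
    unfolding H4_def c4_def by (rule used_insert) (rule n4)
  have "colouring H1 c1"
    unfolding H1_def c1_def by (rule colouring_insert) (use col notin v in simp_all)
  then have "colouring H2 c2"
    unfolding H2_def c2_def by (rule colouring_insert) (use n2 v d in \<open>auto simp: u1\<close>)
  then have "colouring H3 c3"
    unfolding H3_def c3_def by (rule colouring_insert) (use n3 m v d in \<open>auto simp: u1 u2\<close>)
  then have "colouring H4 c4"
    unfolding H4_def c4_def by (rule colouring_insert) (use n4 y d in \<open>auto simp: u1 u2 u3\<close>)
  then have "colouring (insert {x, y} H4) (c4({x, y} := i))"
    by (rule colouring_insert) (use n5 y d in \<open>auto simp: u1 u2 u3 u4\<close>)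
  then show ?thesis 
    unfolding H1_def H2_def H3_def H4_def by (rule exI[of _ "c4({x, y} := i)"])
qed

section \<open>The double star and the normal form of its colourings\<close>

locale double_star =
  fixes V :: "'a set" and E :: "'a set set" and x y z u v w :: 'a
  assumes graph: "fin_simple_graph V E"
    and dist: "distinct [x, y, z, u, v, w]"
    and edges: "{x, y} \<in> E" "{y, z} \<in> E" "{y, v} \<in> E" "{v, u} \<in> E" "{v, w} \<in> E"
    and degrees: "degree E x = 3" "degree E z = 3" "degree E u = 3" "degree E w = 3"
      "degree E y = 4" "degree E v = 4"
begin

text \<open>The graph \<open>H\<close> of the game.\<close>

definition rest :: "'a set set" where
  "rest = E - {{x, y}, {y, z}, {y, v}, {v, u}, {v, w}}"

lemma finite_E: "finite E"
  by (rule finite_subset[of E "Pow V"]) (use graph in \<open>auto simp: fin_simple_graph_def\<close>)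

lemma rest_degrees:
  "degree rest x = 2" "degree rest z = 2" "degree rest u = 2" "degree rest w = 2"
  "degree rest y = 1" "degree rest v = 1"
proof -
  let ?T = "{{x, y}, {y, z}, {y, v}, {v, u}, {v, w}}"
  note deg = degree_Diff[OF finite_E, of ?T, folded rest_def]
  have c3: "card {{x, y}, {y, z}, {y, v}} = 3" "card {{y, v}, {v, u}, {v, w}} = 3"
    using dist by (simp_all add: card_insert_if doubleton_eq_iff)
  have "{t \<in> ?T. x \<in> t} = {{x, y}}" using dist by auto
  from deg[OF this] show "degree rest x = 2" using edges degrees by simp
  have "{t \<in> ?T. z \<in> t} = {{y, z}}" using dist by auto
  from deg[OF this] show "degree rest z = 2" using edges degrees by simp
  have "{t \<in> ?T. u \<in> t} = {{v, u}}" using dist by auto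
  from deg[OF this] show "degree rest u = 2" using edges degrees by simp
  have "{t \<in> ?T. w \<in> t} = {{v, w}}" using dist by auto
  from deg[OF this] show "degree rest w = 2" using edges degrees by simp
  have "{t \<in> ?T. y \<in> t} = {{x, y}, {y, z}, {y, v}}" using dist by auto
  from deg[OF this] show "degree rest y = 1" using edges degrees by (simp add: c3)
  have "{t \<in> ?T. v \<in> t} = {{y, v}, {v, u}, {v, w}}" using dist by auto
  from deg[OF this] show "degree rest v = 1" using edges degrees by (simp add: c3)
qed

lemma kempe: "kempe_state rest [y, v, x, z, u, w]"
proof
  show "finite rest" using finite_E by (simp add: rest_def)
  show "card e = 2" if "e \<in> rest" for e
    using that graph by (simp add: rest_def fin_simple_graph_def)
  show "distinct [y, v, x, z, u, w]" using dist by auto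
qed

lemma extend_normalized:
  fixes c :: "'a set \<Rightarrow> colour"
  assumes c: "colouring (E - {{x, y}}) c"
    and cy: "c {y, z} = C0" "c {y, v} = C1" "used rest c y = {C2}"
    and cv: "(c {v, u}, c {v, w}) \<in> {(C2, C3), (C0, C3), (C0, C2)}"
  shows "\<exists>c' :: 'a set \<Rightarrow> colour. colouring E c'"
proof -
  interpret kempe_state rest "[y, v, x, z, u, w]" by (rule kempe)
  have sub: "rest \<subseteq> E - {{x, y}}" by (auto simp: rest_def)
  have col: "colouring rest c" using c sub by (rule colouring_mono)
  note card = card_used[OF col]
  have mem: "{y, z} \<in> E - {{x, y}}" "{y, v} \<in> E - {{x, y}}" "{v, u} \<in> E - {{x, y}}" "{v, w} \<in> E - {{x, y}}"
    using edges dist by (auto simp: doubleton_eq_iff)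
  have notin: "{x, y} \<notin> rest" "{y, z} \<notin> rest" "{y, v} \<notin> rest" "{v, u} \<notin> rest" "{v, w} \<notin> rest"
    by (simp_all add: rest_def)
  obtain q where q: "used rest c v = {q}"
    using card[of v] rest_degrees(6) by (auto simp: card_1_singleton_iff)
  have "c {y, v} \<notin> used rest c v" "c {v, u} \<notin> used rest c v" "c {v, w} \<notin> used rest c v"
    by (rule used_avoids[OF c _ _ sub]; use mem notin in simp)+
  then have q': "q \<noteq> C1" "q \<noteq> c {v, u}" "q \<noteq> c {v, w}" using cy q by auto
  \<comment> \<open>The set at \<open>x\<close> gets no such restriction, because \<open>xy\<close>
    is uncoloured.\<close>
  have av: "C0 \<notin> used rest c z" "c {v, u} \<notin> used rest c u" "c {v, w} \<notin> used rest c w"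
    unfolding cy(1)[symmetric] by (rule used_avoids[OF c _ _ sub]; use mem notin in simp)+
  obtain X where X: "X \<in> set colour_pairs" "set X = used rest c x"
    using ex_colour_pair card[of x] rest_degrees by metis
  obtain Z where Z: "Z \<in> set colour_pairs" "set Z = used rest c z"
    using ex_colour_pair card[of z] rest_degrees by metis
  obtain U where U: "U \<in> set colour_pairs" "set U = used rest c u"
    using ex_colour_pair card[of u] rest_degrees by metis
  obtain W where W: "W \<in> set colour_pairs" "set W = used rest c w"
    using ex_colour_pair card[of w] rest_degrees by metis
  define s where "s = [[C2], [q], X, Z, U, W]"
  \<comment> \<open>The four edges at \<open>v\<close> have different colours and \<open>yv\<close>
    has \<open>C1\<close>, so \<open>q\<close> is the colour left over by \<open>vu\<close> and
    \<open>vw\<close>.\<close>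
  have "(q, c {v, u}, c {v, w}) \<in> {(C0, C2, C3), (C2, C0, C3), (C3, C0, C2)}"
    using cv q' by (cases q) auto
  then have "s \<in> set initial_states"
    using X(1) Z U W av unfolding initial_states_def s_def by auto
  moreover have "represents c s"
    unfolding represents_def s_def using col cy(3) q X Z U W
    by (auto simp: less_Suc_eq numeral_eq_Suc nth_Cons split: nat.splits)
  ultimately obtain c' s' where c': "represents c' s'" "goal s'"
    using initial_state_sound by blast
  have "set (s' ! m) = used rest c' ([y, v, x, z, u, w] ! m)" if "m < 6" for m
    using c'(1) that by (simp add: represents_def)
  from this[of 0] this[of 1] this[of 2] this[of 3] this[of 4] this[of 5]
  have "\<exists>c'' :: 'a set \<Rightarrow> colour. colouring (insert {x, y} (insert {y, z} (insert {y, v} (insert {v, u} (insert {v, w} rest))))) c''"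
    using c' by (intro goal_extends[OF dist _ notin, of c' s']) (simp_all add: represents_def)
  moreover have "insert {x, y} (insert {y, z} (insert {y, v} (insert {v, u} (insert {v, w} rest)))) = E"
    using edges by (auto simp: rest_def)
  ultimately show ?thesis by simp
qed

end

lemma double_star_extend:
  fixes c :: "'a set \<Rightarrow> nat"
  assumes "double_star V E x y z u v w"
    and proper: "proper_edge_coloring (E - {{x, y}}) 4 c"
  shows "\<exists>c' :: 'a set \<Rightarrow> colour. colouring E c'"
proof -
  interpret S: double_star V E x y z u v w by fact
  \<comment> \<open>The same configuration with \<open>u\<close> and \<open>w\<close> exchanged; it
    halves the number of cases at \<open>v\<close>.\<close>
  interpret S': double_star V E x y z w v u
    using S.graph S.dist S.edges S.degrees by unfold_locales auto
  have rest: "S'.rest = S.rest" unfolding S.rest_def S'.rest_def by auto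
  let ?G = "E - {{x, y}}"
  have col: "colouring ?G c" and lt: "c ` ?G \<subseteq> {..<4}"
    using proper by (simp_all add: proper_edge_coloring_def colouring_def)
  have sub: "S.rest \<subseteq> ?G" by (auto simp: S.rest_def)
  have mem: "{y, z} \<in> ?G" "{y, v} \<in> ?G" "{v, u} \<in> ?G" "{v, w} \<in> ?G"
    using S.edges S.dist by (auto simp: doubleton_eq_iff)
  have notin: "{y, z} \<notin> S.rest" "{y, v} \<notin> S.rest" by (simp_all add: S.rest_def)
  obtain p where p: "used S.rest c y = {p}"
    using card_used[OF colouring_mono[OF col sub], of y] S.rest_degrees(5)
    by (auto simp: card_1_singleton_iff)
  have "c {y, z} \<notin> used S.rest c y" "c {y, v} \<notin> used S.rest c y"
    by (rule used_avoids[OF col _ _ sub]; use mem notin in simp)+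
  then have p': "p \<noteq> c {y, z}" "p \<noteq> c {y, v}" using p by auto
  have yzv: "c {y, z} \<noteq> c {y, v}"
    using colouring_neq[OF col, of "{y, z}" "{y, v}" y] mem S.dist by (auto simp: doubleton_eq_iff)
  have "p \<in> used S.rest c y" by (simp add: p)
  then have "p < 4" using lt sub by (auto simp: used_def)
  \<comment> \<open>Renames the three different colours at \<open>y\<close> to \<open>C0\<close>,
    \<open>C1\<close>, \<open>C2\<close>, as the normal form requires; the default \<open>C3\<close>
    takes the one remaining colour below 4.\<close>
  define f where "f n = (if n = c {y, z} then C0 else if n = c {y, v} then C1
    else if n = p then C2 else C3)" for n
  have lt4: "c {y, z} < 4" "c {y, v} < 4" using lt mem by auto
  have "inj_on f {..<4}"
  proof (rule inj_onI)
    fix i j assume "i \<in> {..<4}" "j \<in> {..<4}" "f i = f j"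
    then show "i = j"
      using fourth_nat_unique[OF lt4 \<open>p < 4\<close>, of i j] p' yzv
      by (auto simp: f_def split: if_splits)
  qed
  then have "inj_on f (c ` ?G)" using lt by (rule inj_on_subset)
  with col have c': "colouring ?G (f \<circ> c)" by (rule colouring_comp)
  have y: "(f \<circ> c) {y, z} = C0" "(f \<circ> c) {y, v} = C1" "used S.rest (f \<circ> c) y = {C2}"
    using p' yzv by (simp_all add: used_comp p f_def)
  have ne: "(f \<circ> c) {v, u} \<noteq> (f \<circ> c) {v, w}" "(f \<circ> c) {v, u} \<noteq> C1" "(f \<circ> c) {v, w} \<noteq> C1"
    using colouring_neq[OF c', of "{v, u}" "{v, w}" v] colouring_neq[OF c', of "{v, u}" "{y, v}" v]
      colouring_neq[OF c', of "{v, w}" "{y, v}" v] mem S.dist y(2)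
    by (auto simp: doubleton_eq_iff)
  \<comment> \<open>Of the six ordered pairs of different colours other than \<open>C1\<close>,
    three are in normal form and the others become so when \<open>u\<close> and \<open>w\<close> are
    exchanged.\<close>
  then consider "((f \<circ> c) {v, u}, (f \<circ> c) {v, w}) \<in> {(C2, C3), (C0, C3), (C0, C2)}"
    | "((f \<circ> c) {v, w}, (f \<circ> c) {v, u}) \<in> {(C2, C3), (C0, C3), (C0, C2)}"
    by (cases "(f \<circ> c) {v, u}"; cases "(f \<circ> c) {v, w}") auto
  then show ?thesis
  proof cases
    case 1
    then show ?thesis using S.extend_normalized[OF c' y] by blast
  next
    case 2
    then show ?thesis using S'.extend_normalized[OF c' y(1,2) y(3)[folded rest]] by blast
  qed
qed

section \<open>From colourings to the chromatic index\<close>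

lemma proper_edge_coloring_subset:
  "proper_edge_coloring E k c \<Longrightarrow> E' \<subseteq> E \<Longrightarrow> proper_edge_coloring E' k c"
  unfolding proper_edge_coloring_def by blast

lemma chromatic_index_attained:
  assumes "finite E"
  shows "\<exists>c. proper_edge_coloring E (chromatic_index E) c"
proof -
  \<comment> \<open>Giving each edge its own colour shows that \<open>LEAST\<close> ranges over a
    nonempty set.\<close>
  obtain c where "bij_betw c E {..<card E}"
    using ex_bij_betw_finite_nat[OF assms] by (auto simp: atLeast0LessThan)
  then have "proper_edge_coloring E (card E) c"
    unfolding proper_edge_coloring_def bij_betw_def inj_on_def by blast
  then have "\<exists>k c. proper_edge_coloring E k c" by blast
  then show ?thesis unfolding chromatic_index_def by (rule LeastI_ex)
qed

lemma proper_edge_coloring_of_colouring: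
  fixes c :: "'a set \<Rightarrow> colour"
  assumes "colouring E c"
  shows "\<exists>c'. proper_edge_coloring E 4 c'"
proof -
  define g :: "colour \<Rightarrow> nat" where "g = (\<lambda>a. case a of C0 \<Rightarrow> 0 | C1 \<Rightarrow> 1 | C2 \<Rightarrow> 2 | C3 \<Rightarrow> 3)"
  have "inj g" by (rule injI) (auto simp: g_def split: colour.splits)
  then have "colouring E (g \<circ> c)"
    by (intro colouring_comp assms) (rule inj_on_subset, auto)
  moreover have "g a < 4" for a by (simp add: g_def split: colour.splits)
  ultimately show ?thesis
    unfolding proper_edge_coloring_def colouring_def by (intro exI[of _ "g \<circ> c"]) auto
qed

theorem proposition2p16:
  fixes V :: "'a set" and E :: "'a set set" and x y z u v w :: 'a and e :: "'a set"
  assumes "fin_simple_graph V E"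
    and "connected_graph V E"
    and "max_degree V E = 4"
    and "distinct [x, y, z, u, v, w]"
    and "{x, y, z, u, v, w} \<subseteq> V"
    and "{x, y} \<in> E" "{y, z} \<in> E" "{y, v} \<in> E" "{v, u} \<in> E" "{v, w} \<in> E"
    and "degree E x = 3" "degree E z = 3" "degree E u = 3" "degree E w = 3"
    and "degree E y = 4" "degree E v = 4"
    and "e = {x, y}"
    and "chromatic_index (E - {e}) = 4"
  shows "chromatic_index E = 4"
proof -
  have star: "double_star V E x y z u v w" using assms by unfold_locales
  have fin: "finite (E - {{x, y}})" using double_star.finite_E[OF star] by simp
  obtain c0 where c0: "proper_edge_coloring (E - {{x, y}}) 4 c0"
    using chromatic_index_attained[OF fin] assms(17,18) by auto
  obtain c where c: "proper_edge_coloring E 4 c"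
    using double_star_extend[OF star c0] proper_edge_coloring_of_colouring by blast
  \<comment> \<open>Lower bound: a colouring of \<open>E\<close> restricts to
    \<open>E - {e}\<close>, whose chromatic index is 4.\<close>
  have "4 \<le> k" if "proper_edge_coloring E k c'" for k c'
  proof -
    have "proper_edge_coloring (E - {e}) k c'" using that by (rule proper_edge_coloring_subset) blast
    then show ?thesis using assms(18) unfolding chromatic_index_def by (metis Least_le)
  qed
  with c show ?thesis unfolding chromatic_index_def by (intro Least_equality) blast+
qed

end
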